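(* Suppose $q=p^n$ where $n\geq 2$ and $p\geq 3$ is a prime. Let $n'$ be a positive divisor of $n$ with $1\leq n'<n$, and set $q'=p^{n'}$. There exists a smooth blocking plane curve defined over $\mathbb{F}_{q}$ with degree $d=\frac{q-1}{q'-1}$.
   Context: A plane curve $C=\{F=0\}\subset\mathbb{P}^2$ of degree $d$ over $\mathbb{F}_q$ is given by a nonzero homogeneous polynomial $F\in\mathbb{F}_q[x,y,z]$ of degree $d$. It is smooth if at every point $P\in C$ (over $\overline{\mathbb{F}_q}$) at least one of the partial derivatives $F_x,F_y,F_z$ does not vanish. $C(\mathbb{F}_q)$ is the set of points $[x:y:z]\in\mathbb{P}^2(\mathbb{F}_q)$ with $F(x,y,z)=0$. A set $B\subseteq\mathbb{P}^2(\mathbb{F}_q)$ is a blocking set if every line of $\mathbb{P}^2$ defined over $\mathbb{F}_q$ (an $\mathbb{F}_q$-line) contains a point of $B$. The curve $C$ is blocking (over $\mathbb{F}_q$) if $C(\mathbb{F}_q)$ is a blocking set. *)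

theory Defs
  imports "HOL-Algebra.Algebraic_Closure_Type" "HOL-Library.Poly_Mapping"
    "HOL-Library.Product_Plus" "HOL-Library.Cardinality" "HOL-Computational_Algebra.Primes"
begin

text \<open>
  A polynomial in \<open>x, y, z\<close> is a finitely supported map from exponent triples to coefficients:
  the key \<open>(i, j, k)\<close> stands for the monomial \<open>x^i * y^j * z^k\<close>.
\<close>

type_synonym 'a poly3 = "(nat \<times> nat \<times> nat) \<Rightarrow>\<^sub>0 'a"

definition eval3 :: "'a::comm_semiring_1 poly3 \<Rightarrow> 'a \<times> 'a \<times> 'a \<Rightarrow> 'a" where
  "eval3 F = (\<lambda>(x, y, z).
     \<Sum>(i, j, k)\<in>Poly_Mapping.keys F. Poly_Mapping.lookup F (i, j, k) * x ^ i * y ^ j * z ^ k)"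

text \<open>Formal partial derivatives; the truncated exponent \<open>0 - 1\<close> only occurs with coefficient 0.\<close>

definition deriv_x :: "'a::comm_semiring_1 poly3 \<Rightarrow> 'a poly3" where
  "deriv_x F = (\<Sum>(i, j, k)\<in>Poly_Mapping.keys F.
     Poly_Mapping.single (i - 1, j, k) (of_nat i * Poly_Mapping.lookup F (i, j, k)))"

definition deriv_y :: "'a::comm_semiring_1 poly3 \<Rightarrow> 'a poly3" where
  "deriv_y F = (\<Sum>(i, j, k)\<in>Poly_Mapping.keys F.
     Poly_Mapping.single (i, j - 1, k) (of_nat j * Poly_Mapping.lookup F (i, j, k)))"

definition deriv_z :: "'a::comm_semiring_1 poly3 \<Rightarrow> 'a poly3" where
  "deriv_z F = (\<Sum>(i, j, k)\<in>Poly_Mapping.keys F.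
     Poly_Mapping.single (i, j, k - 1) (of_nat k * Poly_Mapping.lookup F (i, j, k)))"

definition homogeneous3 :: "nat \<Rightarrow> 'a::zero poly3 \<Rightarrow> bool" where
  "homogeneous3 d F \<longleftrightarrow> (\<forall>(i, j, k)\<in>Poly_Mapping.keys F. i + j + k = d)"

text \<open>
  Points of the projective plane over the field \<open>'a\<close> are the classes of nonzero triples
  modulo nonzero scalars.
\<close>

definition proj_rel :: "(('a::field \<times> 'a \<times> 'a) \<times> ('a \<times> 'a \<times> 'a)) set" where
  "proj_rel = {((x, y, z), (x', y', z')). (x, y, z) \<noteq> 0 \<and>
     (\<exists>c. c \<noteq> 0 \<and> x' = c * x \<and> y' = c * y \<and> z' = c * z)}"

definition proj_plane :: "('a::field \<times> 'a \<times> 'a) set set" where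
  "proj_plane = (- {0}) // proj_rel"

definition proj_line :: "'a::field \<times> 'a \<times> 'a \<Rightarrow> ('a \<times> 'a \<times> 'a) set set" where
  "proj_line = (\<lambda>(a, b, c). {P \<in> proj_plane. \<forall>(x, y, z)\<in>P. a * x + b * y + c * z = 0})"

text \<open>Lines are given by nonzero linear forms with coefficients in the field \<open>'a\<close>.\<close>

definition blocking_set :: "('a::field \<times> 'a \<times> 'a) set set \<Rightarrow> bool" where
  "blocking_set B \<longleftrightarrow> B \<subseteq> proj_plane \<and> (\<forall>l. l \<noteq> 0 \<longrightarrow> proj_line l \<inter> B \<noteq> {})"

definition plane_curve :: "nat \<Rightarrow> 'a::field poly3 \<Rightarrow> bool" where
  "plane_curve d F \<longleftrightarrow> F \<noteq> 0 \<and> homogeneous3 d F"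

text \<open>
  The set of points of the curve \<open>F = 0\<close> with coordinates in the coefficient field of \<open>F\<close>.
  For homogeneous \<open>F\<close>, vanishing does not depend on the representative of \<open>P\<close>.
\<close>

definition curve_points :: "'a::field poly3 \<Rightarrow> ('a \<times> 'a \<times> 'a) set set" where
  "curve_points F = {P \<in> proj_plane. \<forall>v\<in>P. eval3 F v = 0}"

abbreviation base_change :: "'a::field poly3 \<Rightarrow> 'a alg_closure poly3" where
  "base_change F \<equiv> Poly_Mapping.map to_ac F"

definition smooth_curve :: "'a::field poly3 \<Rightarrow> bool" where
  "smooth_curve F \<longleftrightarrow> (\<forall>P\<in>curve_points (base_change F). \<forall>v\<in>P.
     eval3 (deriv_x (base_change F)) v \<noteq> 0 \<or>
     eval3 (deriv_y (base_change F)) v \<noteq> 0 \<or>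
     eval3 (deriv_z (base_change F)) v \<noteq> 0)"

definition blocking_curve :: "'a::field poly3 \<Rightarrow> bool" where
  "blocking_curve F \<longleftrightarrow> blocking_set (curve_points F)"

end

theory Submission
  imports Defs "HOL-Number_Theory.Residues"
begin

text \<open>
  The curve is the Fermat curve of degree \<open>d = (q - 1) / (q' - 1)\<close>. Since \<open>d \<equiv> 1\<close> modulo \<open>p\<close> and
  \<open>d > 1\<close>, it is smooth. The map \<open>x \<mapsto> x ^ d\<close> is the norm from the field with \<open>q\<close> elements to the
  one with \<open>q'\<close> elements, so \<open>(x ^ d + y ^ d + z ^ d) ^ (q' - 1)\<close> takes only the values 0 and 1.
  If the curve missed the line \<open>z = a * x + b * y\<close>, then \<open>(x ^ d + 1 + (a * x + b) ^ d) ^ (q' - 1) - 1\<close>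
  would have all \<open>q\<close> elements as roots, whereas its degree is \<open>q - 1\<close>: the leading coefficient is
  a power of \<open>1 + a ^ d\<close>, which is nonzero because the point \<open>(1, 0, a)\<close> is not on the curve.
\<close>

text \<open>Multiplication by \<open>x\<close> permutes the nonzero elements, so it preserves their
  product, which can be cancelled.\<close>

lemma power_card_minus_one_eq_one:
  fixes x :: "'a::{field,finite}"
  assumes "x \<noteq> 0"
  shows "x ^ (CARD('a) - 1) = 1"
proof -
  have "x ^ (CARD('a) - 1) * \<Prod>(UNIV-{0}) = (\<Prod>y\<in>UNIV-{0}. x * y)"
    by (simp add: prod.distrib)
  also have "\<dots> = \<Prod>(UNIV-{0})"
    by (rule prod.reindex_bij_witness[of _ "\<lambda>y. y / x" "\<lambda>y. x * y"]) (use assms in auto)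
  finally show ?thesis
    by simp
qed

lemma fermat_form_zero_on_line:
  fixes a b :: "'a::{field,finite}"
  assumes char: "prime CHAR('a)" and r: "r = CHAR('a) ^ k" and d: "d * (r - 1) = CARD('a) - 1"
  shows "\<exists>x y. (x \<noteq> 0 \<or> y \<noteq> 0) \<and> x ^ d + y ^ d + (a * x + b * y) ^ d = 0"
proof (rule ccontr)
  assume "\<not> ?thesis"
  then have nz: "x ^ d + y ^ d + (a * x + b * y) ^ d \<noteq> 0" if "x \<noteq> 0 \<or> y \<noteq> 0" for x y
    using that by blast
  have card: "CARD('a) \<ge> 2"
    using card_mono[of "UNIV :: 'a set" "{0, 1}"] by simp
  then have "d * (r - 1) > 0"
    using d by simp
  then have pos: "d > 0" "r > 1"
    by simp_all
  \<comment> \<open>Lying in the subfield with \<open>r\<close> elements is expressed as being fixed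
    by the \<open>r\<close>-th power map.\<close>
  have norm: "(x ^ d) ^ r = x ^ d" for x :: 'a
  proof (cases "x = 0")
    case False
    have "d * r = d + (CARD('a) - 1)"
      using pos d card by (cases r) auto
    then have "(x ^ d) ^ r = x ^ d * x ^ (CARD('a) - 1)"
      by (simp only: power_add flip: power_mult)
    then show ?thesis
      by (simp only: power_card_minus_one_eq_one[OF False] mult_1_right)
  qed (use pos in \<open>simp add: power_0_left\<close>)
  \<comment> \<open>The \<open>r\<close>-th power map is additive and fixes each summand, hence
    fixes \<open>?v\<close>; one factor \<open>?v\<close> is then cancelled.\<close>
  have unit: "(x ^ d + y ^ d + (a * x + b * y) ^ d) ^ (r - 1) = 1" (is "?v ^ _ = 1")
    if "x \<noteq> 0 \<or> y \<noteq> 0" for x y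
  proof -
    have "?v ^ (r - 1) * ?v = ?v ^ r"
      using pos by (intro power_minus_mult) simp
    also have "\<dots> = ?v"
      by (simp only: freshmans_dream'[OF char r] norm)
    finally show ?thesis
      using nz[OF that] by simp
  qed
  \<comment> \<open>\<open>poly R x\<close> is the value of the form at the point
    \<open>(x, 1, a * x + b)\<close> of the line.\<close>
  define R where "R = [:0, 1:] ^ d + (1 + [:b, a:] ^ d)"
  have poly_R: "poly R x = x ^ d + 1 ^ d + (a * x + b * 1) ^ d" for x
    by (simp add: R_def algebra_simps)
  have deg_lin: "degree ([:b, a:] ^ d) \<le> d"
    using degree_power_le[of "[:b, a:]" d] by (auto split: if_splits)
  \<comment> \<open>For \<open>a = 0\<close> the base is constant, so this is not a leading
    coefficient; both sides are then 0 because \<open>d > 0\<close>.\<close>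
  have "coeff ([:b, a:] ^ d) d = a ^ d"
  proof (cases "a = 0")
    case False
    then show ?thesis
      using lead_coeff_power[of "[:b, a:]" d] by (simp add: degree_power_eq)
  next
    case True
    then show ?thesis
      using pos by (simp add: coeff_eq_0 poly_const_pow)
  qed
  moreover have "[:0, 1:] ^ d = (monom 1 d :: 'a poly)"
    by (simp add: monom_altdef)
  ultimately have "coeff R d = 1 + a ^ d"
    using pos by (simp add: R_def)
  also have "\<dots> \<noteq> 0"
    using nz[of 1 0] pos by (simp add: power_0_left)
  finally have "coeff R d \<noteq> 0" .
  moreover have "degree R \<le> d"
    unfolding R_def by (intro degree_add_le deg_lin) (auto intro: order.trans[OF degree_power_le])
  ultimately have deg_R: "degree R = d"
    by (simp add: le_antisym le_degree)
  then have deg: "degree (R ^ (r - 1)) = CARD('a) - 1"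
    using pos d by (subst degree_power_eq) (auto simp: mult.commute)
  \<comment> \<open>The degree is positive, so the polynomial whose roots are counted below is not
    zero.\<close>
  then have neq: "R ^ (r - 1) \<noteq> 1"
    using card by auto
  have "card {x. poly (R ^ (r - 1) - 1) x = 0} \<le> degree (R ^ (r - 1) - 1)"
    by (intro card_poly_roots_bound) (use neq in simp)
  also have "\<dots> \<le> CARD('a) - 1"
    by (intro degree_diff_le) (use deg in auto)
  also have "{x. poly (R ^ (r - 1) - 1) x = 0} = UNIV"
    using unit[of _ 1] by (simp add: poly_R)
  finally show False
    using card by simp
qed

text \<open>The equation of the line is solved for a coordinate with nonzero coefficient; the
  symmetry of the Fermat form lets any coordinate take that role.\<close>

lemma fermat_form_zero_on_any_line:
  fixes a b c :: "'a::{field,finite}"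
  assumes "prime CHAR('a)" and "r = CHAR('a) ^ k" and "d * (r - 1) = CARD('a) - 1"
    and "(a, b, c) \<noteq> 0"
  obtains x y z where "(x, y, z) \<noteq> 0" "a * x + b * y + c * z = 0" "x ^ d + y ^ d + z ^ d = 0"
proof -
  note zero = fermat_form_zero_on_line[OF assms(1-3)]
  consider "c \<noteq> 0" | "b \<noteq> 0" | "a \<noteq> 0"
    using assms(4) by (auto simp: zero_prod_def)
  then show ?thesis
  proof cases
    case 1
    obtain x y where "x \<noteq> 0 \<or> y \<noteq> 0" "x ^ d + y ^ d + (- a / c * x + - b / c * y) ^ d = 0"
      using zero by blast
    with 1 show ?thesis
      by (intro that[of x y "- a / c * x + - b / c * y"]) (auto simp: zero_prod_def field_simps)
  next
    case 2
    obtain x z where "x \<noteq> 0 \<or> z \<noteq> 0" "x ^ d + z ^ d + (- a / b * x + - c / b * z) ^ d = 0"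
      using zero by blast
    with 2 show ?thesis
      by (intro that[of x "- a / b * x + - c / b * z" z]) (auto simp: zero_prod_def field_simps)
  next
    case 3
    obtain y z where "y \<noteq> 0 \<or> z \<noteq> 0" "y ^ d + z ^ d + (- b / a * y + - c / a * z) ^ d = 0"
      using zero by blast
    with 3 show ?thesis
      by (intro that[of "- b / a * y + - c / a * z" y z]) (auto simp: zero_prod_def field_simps)
  qed
qed

definition fermat :: "nat \<Rightarrow> 'a::comm_semiring_1 poly3" where
  "fermat d = Poly_Mapping.single (d, 0, 0) 1 + Poly_Mapping.single (0, d, 0) 1
     + Poly_Mapping.single (0, 0, d) 1"

text \<open>Positivity of \<open>d\<close> keeps the three exponent triples distinct, so no
  coefficients add up.\<close>

lemma lookup_fermat:
  assumes "d > 0"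
  shows "Poly_Mapping.lookup (fermat d) m = (if m \<in> {(d, 0, 0), (0, d, 0), (0, 0, d)} then 1 else 0)"
  using assms by (auto simp: fermat_def lookup_add lookup_single when_def)

lemma keys_fermat:
  assumes "d > 0"
  shows "Poly_Mapping.keys (fermat d :: 'a::comm_semiring_1 poly3) = {(d, 0, 0), (0, d, 0), (0, 0, d)}"
  using assms by (auto simp: in_keys_iff lookup_fermat split: if_splits)

lemma eval3_fermat:
  assumes "d > 0"
  shows "eval3 (fermat d) (x, y, z) = x ^ d + y ^ d + z ^ d"
  using assms by (simp add: eval3_def keys_fermat lookup_fermat add.assoc)

lemma plane_curve_fermat:
  assumes "d > 0"
  shows "plane_curve d (fermat d)"
proof -
  have "Poly_Mapping.lookup (fermat d :: 'a poly3) (d, 0, 0) \<noteq> 0"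
    by (simp add: lookup_fermat assms)
  then have "fermat d \<noteq> (0 :: 'a poly3)"
    by (metis lookup_zero)
  then show ?thesis
    by (simp add: plane_curve_def homogeneous3_def keys_fermat assms)
qed

lemma base_change_fermat:
  assumes "d > 0"
  shows "base_change (fermat d) = fermat d"
  by (rule poly_mapping_eqI) (simp add: map.rep_eq lookup_fermat assms when_def)

lemma eval3_single: "eval3 (Poly_Mapping.single (i, j, k) c) (x, y, z) = c * x ^ i * y ^ j * z ^ k"
  by (simp add: eval3_def)

lemma eval3_deriv_fermat:
  assumes "d > 0"
  shows "eval3 (deriv_x (fermat d)) (x, y, z) = of_nat d * x ^ (d - 1)"
    and "eval3 (deriv_y (fermat d)) (x, y, z) = of_nat d * y ^ (d - 1)"
    and "eval3 (deriv_z (fermat d)) (x, y, z) = of_nat d * z ^ (d - 1)"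
  using assms
  by (simp_all add: deriv_x_def deriv_y_def deriv_z_def keys_fermat lookup_fermat eval3_single)

lemma zero_notin_proj_plane: "P \<in> proj_plane \<Longrightarrow> 0 \<notin> P"
  by (auto simp: proj_plane_def proj_rel_def zero_prod_def elim!: quotientE)

text \<open>The partial derivatives are \<open>d\<close> times the powers of the coordinates with
  exponent \<open>d - 1\<close>. They vanish together only at the zero triple, which represents no
  point.\<close>

lemma smooth_curve_fermat:
  assumes "d > 1" and "of_nat d \<noteq> (0 :: 'a::field)"
  shows "smooth_curve (fermat d :: 'a poly3)"
proof -
  have "to_ac (of_nat d :: 'a) \<noteq> 0"
    using assms(2) by (subst to_ac_eq_0_iff)
  then have "of_nat d \<noteq> (0 :: 'a alg_closure)"
    by simp
  moreover have "(x, y, z) \<noteq> 0" if "P \<in> proj_plane" "(x, y, z) \<in> P" for x y z :: "'a alg_closure" and P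
    using that zero_notin_proj_plane by metis
  ultimately show ?thesis
    using assms(1)
    by (force simp: smooth_curve_def base_change_fermat eval3_deriv_fermat curve_points_def
        zero_prod_def)
qed

lemma blocking_curve_fermat:
  assumes "prime CHAR('a::{field,finite})" and "r = CHAR('a) ^ k" and "d * (r - 1) = CARD('a) - 1"
    and "d > 0"
  shows "blocking_curve (fermat d :: 'a poly3)"
proof -
  have "proj_line l \<inter> curve_points (fermat d) \<noteq> {}" if "l \<noteq> 0" for l :: "'a \<times> 'a \<times> 'a"
  proof -
    obtain a b c where l: "l = (a, b, c)"
      by (cases l)
    obtain x y z where v: "(x, y, z) \<noteq> 0" "a * x + b * y + c * z = 0" "x ^ d + y ^ d + z ^ d = 0"
      using fermat_form_zero_on_any_line[OF assms(1-3)] \<open>l \<noteq> 0\<close> l by metis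
    define P where "P = proj_rel `` {(x, y, z)}"
    have P: "P \<in> proj_plane"
      using v(1) by (auto simp: P_def proj_plane_def intro: quotientI)
    have P_iff: "w \<in> P \<longleftrightarrow> (\<exists>s. s \<noteq> 0 \<and> w = (s * x, s * y, s * z))" for w
      using v(1) by (auto simp: P_def proj_rel_def)
    \<comment> \<open>Line and curve quantify over all representatives of a point, so both equations
      are checked on every multiple of the vector.\<close>
    have "a * (s * x) + b * (s * y) + c * (s * z) = 0" for s
      using arg_cong[OF v(2), of "(*) s"] by (simp add: algebra_simps)
    then have "P \<in> proj_line l"
      using P by (auto simp: proj_line_def l P_iff)
    moreover have "(s * x) ^ d + (s * y) ^ d + (s * z) ^ d = 0" for s
      using arg_cong[OF v(3), of "(*) (s ^ d)"] by (simp add: algebra_simps)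
    then have "P \<in> curve_points (fermat d)"
      using P by (auto simp: curve_points_def P_iff eval3_fermat[OF assms(4)])
    ultimately show ?thesis
      by blast
  qed
  then show ?thesis
    by (auto simp: blocking_curve_def blocking_set_def curve_points_def)
qed

theorem theorem4p3:
  fixes p n n' q q' d :: nat
  assumes "prime p" and "p \<ge> 3" and "n \<ge> 2"
    and "1 \<le> n'" and "n' < n" and "n' dvd n"
    and "q = p ^ n" and "q' = p ^ n'"
    and "d = (q - 1) div (q' - 1)"
    and "CARD('a) = q"
  shows "\<exists>F :: ('a::{field,finite}) poly3. plane_curve d F \<and> smooth_curve F \<and> blocking_curve F"
proof -
  have prime_char: "prime CHAR('a)"
    using prime_CHAR_semidom[where ?'a = 'a] finite_imp_CHAR_pos[where ?'a = 'a] by simp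
  have "CHAR('a) dvd p ^ n"
    using CHAR_dvd_CARD[where ?'a = 'a] assms by simp
  then have char: "CHAR('a) = p"
    using prime_char \<open>prime p\<close> by (metis prime_dvd_power primes_dvd_imp_eq)
  have q': "q' > 1" "q' < q"
    using assms by (auto intro!: one_less_power power_strict_increasing simp del: One_nat_def)
  obtain m where "n = n' * m"
    using \<open>n' dvd n\<close> by blast
  then have "q = q' ^ m"
    using assms by (simp add: power_mult)
  \<comment> \<open>Modulo \<open>q' - 1\<close>, the number \<open>q'\<close> is 1, and so is its
    power \<open>q\<close>.\<close>
  then have "(q' - 1) dvd (q - 1)"
    using q' cong_pow[of q' 1 "q' - 1" m] by (simp add: cong_altdef_nat)
  then have d: "d * (q' - 1) = q - 1"
    using assms by simp
  have "d > 1"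
    using d q' by (cases d) (auto intro: Nat.gr0I)
  have zero: "of_nat q = (0 :: 'a)" "of_nat q' = (0 :: 'a)"
    using assms char by (auto simp: of_nat_eq_0_iff_char_dvd)
  \<comment> \<open>As \<open>q\<close> and \<open>q'\<close> vanish in the field, this reads
    \<open>- d = - 1\<close> there.\<close>
  have "of_nat d * (of_nat q' - 1 :: 'a) = of_nat q - 1"
    using arg_cong[OF d, of "of_nat :: nat \<Rightarrow> 'a"] q' by (simp add: of_nat_diff)
  then have "of_nat d \<noteq> (0 :: 'a)"
    by (auto simp: zero)
  moreover have "blocking_curve (fermat d :: 'a poly3)"
    using blocking_curve_fermat[where ?'a = 'a and r = q' and k = n'] prime_char char d assms
      \<open>d > 1\<close> by simp
  ultimately show ?thesis
    using plane_curve_fermat smooth_curve_fermat \<open>d > 1\<close> by (metis less_trans zero_less_one)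
qed

end
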